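(* Let $A \in \mathbb{R}^{m\times n}$, $b\in\mathbb{R}^m$, $c \in \mathbb{R}^n$, and consider the linear program: maximize $c^T x$ subject to $Ax=b$, $x\ge 0$, $x\in\mathbb{R}^n$. Suppose that the linear program is completely non-degenerate. Then, started from the dictionary $D(B)$ of any (not necessarily primal feasible) basis $B$, the artificial-free phase 1 algorithm described in the context terminates after finitely many iterations, regardless of how ties are broken.
   Context: Write $a_{.j}$ for the $j$-th column of $A$. A basis is an index set $B\subseteq\{1,\dots,n\}$ with $|B|=m$ such that $A_B:=[a_{.j}\mid j\in B]$ is invertible; its non-basis is $N:=\{1,\dots,n\}\setminus B$, and $A_N$ is the matrix of the columns of $A$ indexed by $N$. Let $c_B, c_N$ be the corresponding subvectors of $c$. The dictionary $D(B)$ has rows indexed by $\{0\}\cup B$ and columns indexed by $\{0\}\cup N$, with entries $d_{ij}$ given by $d_{00}=c_B^TA_B^{-1}b$, $(d_{0j})_{j\in N}=-(c_N^T-c_B^TA_B^{-1}A_N)$, $(d_{i0})_{i\in B}=A_B^{-1}b$, and $(d_{ij})_{i\in B,\,j\in N}=A_B^{-1}A_N$. Here the rows of $A_B^{-1}b$ and $A_B^{-1}A_N$ are indexed by $B$ so that row $i$ corresponds to the basic variable $x_i$. The associated basic solution is $x_B=A_B^{-1}b$, $x_N=0$. The basis $B$ (or the dictionary $D(B)$) is primal feasible if $d_{i0}\ge 0$ for all $i\in B$. The linear program is completely non-degenerate if, for every basis $B$, $d_{i0}\neq 0$ for all $i\in B$, i.e. no basic variable has value zero in any basic solution, feasible or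 not. Artificial-free phase 1 algorithm (input: a dictionary $D(B)$; goal: obtain primal feasibility). An iteration is one pass through Steps 1–7. Step 1: Let $L=\{i\in B : d_{i0}<0\}$. If $L=\emptyset$, exit, reporting that $D(B)$ is primal feasible. Step 2: Compute $W(B)\in\mathbb{R}^N$ by $W(B)_j=\sum_{l\in L} d_{lj}$ for $j\in N$. Step 3: Let $K=\{j\in N : W(B)_j<0\}$. If $K=\emptyset$, exit, reporting primal infeasibility. Step 4: Choose $p\in K$ with $W(B)_p\le W(B)_k$ for all $k\in K$ (ties broken arbitrarily). Step 5: Choose $r\in B$ minimizing $d_{i0}/d_{ip}$ over all $i\in B$ such that either ($d_{i0}<0$ and $d_{ip}<0$) or ($d_{i0}\ge 0$ and $d_{ip}>0$) (any minimizer may be chosen). Step 6: Pivot on $(r,p)$: replace $B$ by $(B\cup\{p\})\setminus\{r\}$ and $N$ by $(N\setminus\{p\})\cup\{r\}$, and update $D(B)$ to the dictionary of the new basis. Step 7: Go to Step 1. *)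

theory Defs
  imports
    Complex_Main
    "Jordan_Normal_Form.DL_Submatrix"
    "Jordan_Normal_Form.Gauss_Jordan_Elimination"
begin

(* The linear program "maximize c^T x subject to A x = b, x >= 0" is given by its data (A, b, c).
   Columns of A are numbered from 0, so variable indices range over {..<dim_col A}. *)

definition nonbasis :: "real mat \<Rightarrow> nat set \<Rightarrow> nat set" where
  "nonbasis A B = {..<dim_col A} - B"

(* Columns (and entries, for subvectors) are listed in increasing order of their indices:
   the k-th one is pick S k, and index i in S sits at position index_pos S i. *)

definition cols_of :: "real mat \<Rightarrow> nat set \<Rightarrow> real mat" where
  "cols_of A S = submatrix A UNIV S"

definition subvec :: "real vec \<Rightarrow> nat set \<Rightarrow> real vec" where
  "subvec v S = vec (card S) (\<lambda>k. v $ pick S k)"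

definition index_pos :: "nat set \<Rightarrow> nat \<Rightarrow> nat" where
  "index_pos S i = card {a \<in> S. a < i}"

definition is_basis :: "real mat \<Rightarrow> nat set \<Rightarrow> bool" where
  "is_basis A B \<longleftrightarrow>
     B \<subseteq> {..<dim_col A} \<and> card B = dim_row A \<and> invertible_mat (cols_of A B)"

definition basis_inv :: "real mat \<Rightarrow> nat set \<Rightarrow> real mat" where
  "basis_inv A B = the (mat_inverse (cols_of A B))"

(* The special row and column "0" of the dictionary is None, which keeps it apart from the variable
   index 0.  Only rows None, Some i with i in B and columns None, Some j with j in N are meaningful. *)
fun dictionary ::
  "real mat \<Rightarrow> real vec \<Rightarrow> real vec \<Rightarrow> nat set \<Rightarrow> nat option \<Rightarrow> nat option \<Rightarrow> real" where
  "dictionary A b c B None None = subvec c B \<bullet> (basis_inv A B *\<^sub>v b)"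
| "dictionary A b c B None (Some j) =
     (let N = nonbasis A B in
      (- (subvec c N - transpose_mat (basis_inv A B * cols_of A N) *\<^sub>v subvec c B)) $ index_pos N j)"
| "dictionary A b c B (Some i) None = (basis_inv A B *\<^sub>v b) $ index_pos B i"
| "dictionary A b c B (Some i) (Some j) =
     (let N = nonbasis A B in
      (basis_inv A B * cols_of A N) $$ (index_pos B i, index_pos N j))"

definition completely_nondegenerate :: "real mat \<Rightarrow> real vec \<Rightarrow> real vec \<Rightarrow> bool" where
  "completely_nondegenerate A b c \<longleftrightarrow>
     (\<forall>B. is_basis A B \<longrightarrow> (\<forall>i\<in>B. dictionary A b c B (Some i) None \<noteq> 0))"

definition infeasible_rows :: "(nat option \<Rightarrow> nat option \<Rightarrow> real) \<Rightarrow> nat set \<Rightarrow> nat set" where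
  "infeasible_rows d B = {i \<in> B. d (Some i) None < 0}"

definition infeasibility_vec ::
  "(nat option \<Rightarrow> nat option \<Rightarrow> real) \<Rightarrow> nat set \<Rightarrow> nat \<Rightarrow> real" where
  "infeasibility_vec d B j = (\<Sum>l\<in>infeasible_rows d B. d (Some l) (Some j))"

definition candidate_cols ::
  "(nat option \<Rightarrow> nat option \<Rightarrow> real) \<Rightarrow> nat set \<Rightarrow> nat set \<Rightarrow> nat set" where
  "candidate_cols d B N = {j \<in> N. infeasibility_vec d B j < 0}"

definition entering_choice ::
  "(nat option \<Rightarrow> nat option \<Rightarrow> real) \<Rightarrow> nat set \<Rightarrow> nat set \<Rightarrow> nat \<Rightarrow> bool" where
  "entering_choice d B N p \<longleftrightarrow>
     p \<in> candidate_cols d B N \<and>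
     (\<forall>k\<in>candidate_cols d B N. infeasibility_vec d B p \<le> infeasibility_vec d B k)"

definition ratio_rows ::
  "(nat option \<Rightarrow> nat option \<Rightarrow> real) \<Rightarrow> nat set \<Rightarrow> nat \<Rightarrow> nat set" where
  "ratio_rows d B p =
     {i \<in> B. (d (Some i) None < 0 \<and> d (Some i) (Some p) < 0) \<or>
             (d (Some i) None \<ge> 0 \<and> d (Some i) (Some p) > 0)}"

definition leaving_choice ::
  "(nat option \<Rightarrow> nat option \<Rightarrow> real) \<Rightarrow> nat set \<Rightarrow> nat \<Rightarrow> nat \<Rightarrow> bool" where
  "leaving_choice d B p r \<longleftrightarrow>
     r \<in> ratio_rows d B p \<and>
     (\<forall>i\<in>ratio_rows d B p.
        d (Some r) None / d (Some r) (Some p) \<le> d (Some i) None / d (Some i) (Some p))"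

datatype phase1_state =
    At "nat set"
  | Exit_Feasible "nat set"
  | Exit_Infeasible "nat set"

fun is_exit :: "phase1_state \<Rightarrow> bool" where
  "is_exit (At B) = False"
| "is_exit (Exit_Feasible B) = True"
| "is_exit (Exit_Infeasible B) = True"

(* Nondeterministic in p and r, so that every tie-breaking is a run.  The dictionary D(B) exists only
   for a basis B; a run that reached a non-basis would have no successor and would not be an exit. *)
inductive phase1_step ::
  "real mat \<Rightarrow> real vec \<Rightarrow> real vec \<Rightarrow> phase1_state \<Rightarrow> phase1_state \<Rightarrow> bool"
  for A :: "real mat" and b c :: "real vec" where
  exit_feasible:
    "\<lbrakk>is_basis A B;
      infeasible_rows (dictionary A b c B) B = {}\<rbrakk>
     \<Longrightarrow> phase1_step A b c (At B) (Exit_Feasible B)"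
| exit_infeasible:
    "\<lbrakk>is_basis A B;
      infeasible_rows (dictionary A b c B) B \<noteq> {};
      candidate_cols (dictionary A b c B) B (nonbasis A B) = {}\<rbrakk>
     \<Longrightarrow> phase1_step A b c (At B) (Exit_Infeasible B)"
| pivot:
    "\<lbrakk>is_basis A B;
      infeasible_rows (dictionary A b c B) B \<noteq> {};
      entering_choice (dictionary A b c B) B (nonbasis A B) p;
      leaving_choice (dictionary A b c B) B p r\<rbrakk>
     \<Longrightarrow> phase1_step A b c (At B) (At ((B \<union> {p}) - {r}))"

(* Every run from s is finite, and a run can only stop in a final state (it never gets stuck). *)
definition always_terminates :: "('s \<Rightarrow> 's \<Rightarrow> bool) \<Rightarrow> ('s \<Rightarrow> bool) \<Rightarrow> 's \<Rightarrow> bool" where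
  "always_terminates step final s \<longleftrightarrow>
     (\<nexists>f :: nat \<Rightarrow> 's. f 0 = s \<and> (\<forall>k. step (f k) (f (Suc k)))) \<and>
     (\<forall>t. step\<^sup>*\<^sup>* s t \<longrightarrow> final t \<or> (\<exists>u. step t u))"

end

theory Submission
  imports Defs "Jordan_Normal_Form.Determinant"
begin

text \<open>
  The algorithm climbs a strictly increasing potential, the (negative) total infeasibility
  \<open>\<Sum>i\<in>B. min d\<^sub>i\<^sub>0 0\<close> of the basic solution, and there are only finitely many bases.

  When the entering variable \<open>p\<close> is raised from \<open>0\<close> to \<open>t\<close>, the basic variable \<open>i\<close>
  moves to \<open>d\<^sub>i\<^sub>0 - t d\<^sub>i\<^sub>p\<close>, and the total of the infeasible variables changes at the rate
  \<open>- W(B)\<^sub>p > 0\<close>.  The ratio test stops at the first \<open>t\<close> at which some basic variable,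
  feasible or infeasible, would change its sign.  Up to that point every feasible variable stays
  feasible and every infeasible one stays nonpositive, so the potential equals that total and grows
  by exactly \<open>- t W(B)\<^sub>p\<close> (lemma \<open>infeasibility_pivot\<close>).  Complete non-degeneracy is what
  makes the step length \<open>t\<close> nonzero.

  Two facts support this.  A pivot on a nonzero entry leads to a basis and updates the basic solution
  as described (lemmas \<open>is_basis_pivot\<close> and \<open>basic_solution_pivot\<close>); both follow from the
  description of the dictionary by linear combinations of the columns of \<open>A\<close>, rather than from
  matrix inverses.  And the algorithm never gets stuck: \<open>W(B)\<^sub>p < 0\<close> is a sum over the infeasible
  rows, so one of its summands is negative and that row takes part in the ratio test.
\<close>

section \<open>Bases and dictionaries as linear combinations of columns\<close>

definition col_comb :: "real mat \<Rightarrow> nat set \<Rightarrow> (nat \<Rightarrow> real) \<Rightarrow> real vec" where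
  "col_comb A S y = vec (dim_row A) (\<lambda>k. \<Sum>i\<in>S. A $$ (k, i) * y i)"

lemma index_pos_pick: "q < card S \<Longrightarrow> index_pos S (pick S q) = q"
  by (simp add: index_pos_def card_pick)

lemma pick_index_pos: "i \<in> S \<Longrightarrow> pick S (index_pos S i) = i"
  by (simp add: index_pos_def pick_card_in_set)

lemma index_pos_less: "finite S \<Longrightarrow> i \<in> S \<Longrightarrow> index_pos S i < card S"
  unfolding index_pos_def by (rule psubset_card_mono) auto

lemma bij_betw_pick: "finite S \<Longrightarrow> bij_betw (pick S) {..<card S} S"
  by (rule bij_betw_byWitness[where f' = "index_pos S"])
     (auto simp: index_pos_pick pick_index_pos index_pos_less pick_in_set)

lemma cols_of_carrier:
  assumes "S \<subseteq> {..<dim_col A}"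
  shows "cols_of A S \<in> carrier_mat (dim_row A) (card S)"
proof -
  have "{j. j < dim_col A \<and> j \<in> S} = S" using assms by auto
  then show ?thesis by (intro carrier_matI) (simp_all add: cols_of_def dim_submatrix)
qed

lemma cols_of_index:
  assumes "S \<subseteq> {..<dim_col A}" "k < dim_row A" "q < card S"
  shows "cols_of A S $$ (k, q) = A $$ (k, pick S q)"
proof -
  have "{j. j < dim_col A \<and> j \<in> S} = S" using assms(1) by auto
  then show ?thesis using assms by (simp add: cols_of_def submatrix_index pick_UNIV)
qed

lemma cols_of_mult_vec:
  assumes S: "S \<subseteq> {..<dim_col A}" and v: "v \<in> carrier_vec (card S)"
  shows "cols_of A S *\<^sub>v v = col_comb A S (\<lambda>i. v $ index_pos S i)"
proof (rule eq_vecI)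
  have fin: "finite S" using S finite_subset by blast
  have C: "cols_of A S \<in> carrier_mat (dim_row A) (card S)" by (rule cols_of_carrier[OF S])
  then show "dim_vec (cols_of A S *\<^sub>v v) = dim_vec (col_comb A S (\<lambda>i. v $ index_pos S i))"
    by (simp add: col_comb_def)
  fix k assume "k < dim_vec (col_comb A S (\<lambda>i. v $ index_pos S i))"
  then have k: "k < dim_row A" by (simp add: col_comb_def)
  have "(cols_of A S *\<^sub>v v) $ k = (\<Sum>q\<in>{..<card S}. cols_of A S $$ (k, q) * v $ q)"
    using C k v by (simp add: scalar_prod_def atLeast0LessThan)
  also have "\<dots> = (\<Sum>q\<in>{..<card S}. A $$ (k, pick S q) * v $ index_pos S (pick S q))"
    using S k by (intro sum.cong) (auto simp: cols_of_index index_pos_pick)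
  also have "\<dots> = (\<Sum>i\<in>S. A $$ (k, i) * v $ index_pos S i)"
    by (rule sum.reindex_bij_betw[OF bij_betw_pick[OF fin]])
  finally show "(cols_of A S *\<^sub>v v) $ k = col_comb A S (\<lambda>i. v $ index_pos S i) $ k"
    using k by (simp add: col_comb_def)
qed

text \<open>For a square system, invertibility is injectivity; this turns the basis property into linear
  independence of the chosen columns, which is what an exchange argument can handle.\<close>

lemma is_basis_iff:
  assumes S: "S \<subseteq> {..<dim_col A}" and card: "card S = dim_row A"
  shows "is_basis A S \<longleftrightarrow>
    (\<forall>y. col_comb A S y = 0\<^sub>v (dim_row A) \<longrightarrow> (\<forall>i\<in>S. y i = 0))"
    (is "_ = ?indep")
proof -
  let ?m = "dim_row A" and ?C = "cols_of A S"
  have fin: "finite S" using S finite_subset by blast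
  have C: "?C \<in> carrier_mat ?m ?m" using cols_of_carrier[OF S] card by simp
  have "is_basis A S \<longleftrightarrow> det ?C \<noteq> 0"
  proof
    assume "is_basis A S"
    then obtain D where D: "?C * D = 1\<^sub>m ?m" "D * ?C = 1\<^sub>m (dim_row D)"
      using C unfolding is_basis_def invertible_mat_def inverts_mat_def by auto
    have "dim_col D = ?m" using arg_cong[OF D(1), of dim_col] by simp
    moreover have "dim_row D = ?m" using arg_cong[OF D(2), of dim_col] C by simp
    ultimately have "D \<in> carrier_mat ?m ?m" by auto
    then have "det ?C * det D = 1" using D(1) det_mult[OF C] det_one by metis
    then show "det ?C \<noteq> 0" by auto
  next
    assume "det ?C \<noteq> 0"
    from det_non_zero_imp_unit[OF C this, of "()"]
    obtain D where "D \<in> carrier_mat ?m ?m" "D * ?C = 1\<^sub>m ?m" "?C * D = 1\<^sub>m ?m"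
      unfolding Units_def ring_mat_def by auto
    then have "invertible_mat ?C"
      using C unfolding invertible_mat_def inverts_mat_def by auto
    then show "is_basis A S" using S card unfolding is_basis_def by simp
  qed
  also have "\<dots> \<longleftrightarrow> (\<forall>v\<in>carrier_vec ?m. ?C *\<^sub>v v = 0\<^sub>v ?m \<longrightarrow> v = 0\<^sub>v ?m)"
    using det_0_iff_vec_prod_zero[OF C] by auto
  also have "\<dots> \<longleftrightarrow> ?indep"
  proof (intro iffI allI impI ballI)
    fix y i
    assume inj: "\<forall>v\<in>carrier_vec ?m. ?C *\<^sub>v v = 0\<^sub>v ?m \<longrightarrow> v = 0\<^sub>v ?m"
      and y: "col_comb A S y = 0\<^sub>v ?m" and i: "i \<in> S"
    let ?v = "vec ?m (\<lambda>q. y (pick S q))"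
    have entry: "?v $ index_pos S j = y j" if "j \<in> S" for j
      using that index_pos_less[OF fin that] by (simp add: pick_index_pos card)
    have "?C *\<^sub>v ?v = col_comb A S y"
      using entry card by (simp add: cols_of_mult_vec[OF S] col_comb_def)
    then have "?v = 0\<^sub>v ?m" using inj y by simp
    then show "y i = 0" using entry[OF i] index_pos_less[OF fin i] card by simp
  next
    fix v
    assume indep: ?indep and v: "v \<in> carrier_vec ?m" and "?C *\<^sub>v v = 0\<^sub>v ?m"
    then have "\<forall>i\<in>S. v $ index_pos S i = 0"
      using cols_of_mult_vec[OF S, of v] card by auto
    then have "v $ q = 0" if "q < ?m" for q
      using that card index_pos_pick[of q S] pick_in_set[of q S] by metis
    then show "v = 0\<^sub>v ?m" using v by auto
  qed
  finally show ?thesis .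
qed

lemma is_basis_subset: "is_basis A B \<Longrightarrow> B \<subseteq> {..<dim_col A}"
  and is_basis_card: "is_basis A B \<Longrightarrow> card B = dim_row A"
  by (simp_all add: is_basis_def)

lemma is_basis_finite: "is_basis A B \<Longrightarrow> finite B"
  using is_basis_subset finite_subset by blast

lemma basis_coefficients_unique:
  assumes B: "is_basis A B" and eq: "col_comb A B y = col_comb A B z" and i: "i \<in> B"
  shows "y i = z i"
proof -
  have "col_comb A B (\<lambda>i. y i - z i) = col_comb A B y - col_comb A B z"
    by (auto simp: col_comb_def sum_subtractf algebra_simps)
  also have "\<dots> = 0\<^sub>v (dim_row A)"
    using eq by (auto simp: col_comb_def)
  finally show ?thesis
    using i B is_basis_iff[OF is_basis_subset[OF B] is_basis_card[OF B]] by fastforce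
qed

lemma basis_inv:
  assumes B: "is_basis A B"
  shows "basis_inv A B \<in> carrier_mat (dim_row A) (dim_row A)"
    and "cols_of A B * basis_inv A B = 1\<^sub>m (dim_row A)"
proof -
  let ?m = "dim_row A" and ?C = "cols_of A B"
  have C: "?C \<in> carrier_mat ?m ?m"
    using cols_of_carrier[OF is_basis_subset[OF B]] is_basis_card[OF B] by simp
  obtain D where D: "?C * D = 1\<^sub>m ?m" "D * ?C = 1\<^sub>m (dim_row D)"
    using B C unfolding is_basis_def invertible_mat_def inverts_mat_def by auto
  have "dim_col D = ?m" using arg_cong[OF D(1), of dim_col] by simp
  moreover have "dim_row D = ?m" using arg_cong[OF D(2), of dim_col] C by simp
  ultimately have "?C \<in> Units (ring_mat TYPE(real) ?m ())"
    using C D unfolding Units_def ring_mat_def by auto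
  then obtain E where E: "mat_inverse ?C = Some E"
    using mat_inverse(1)[OF C, of "()"] by (cases "mat_inverse ?C") auto
  then show "basis_inv A B \<in> carrier_mat ?m ?m" "?C * basis_inv A B = 1\<^sub>m ?m"
    using mat_inverse(2)[OF C E] by (simp_all add: basis_inv_def)
qed

lemma col_comb_basic_solution:
  assumes B: "is_basis A B" and b: "b \<in> carrier_vec (dim_row A)"
  shows "col_comb A B (\<lambda>i. dictionary A b c B (Some i) None) = b"
proof -
  let ?m = "dim_row A"
  note inv = basis_inv[OF B]
  have C: "cols_of A B \<in> carrier_mat ?m ?m"
    using cols_of_carrier[OF is_basis_subset[OF B]] is_basis_card[OF B] by simp
  have "col_comb A B (\<lambda>i. dictionary A b c B (Some i) None)
      = cols_of A B *\<^sub>v (basis_inv A B *\<^sub>v b)"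
    using cols_of_mult_vec[OF is_basis_subset[OF B], of "basis_inv A B *\<^sub>v b"] inv(1) b
    by (simp add: is_basis_card[OF B])
  also have "\<dots> = (cols_of A B * basis_inv A B) *\<^sub>v b"
    using assoc_mult_mat_vec[OF C inv(1) b] by simp
  finally show ?thesis using inv(2) b by simp
qed

lemma col_comb_dictionary_col:
  assumes B: "is_basis A B" and p: "p \<in> nonbasis A B"
  shows "col_comb A B (\<lambda>i. dictionary A b c B (Some i) (Some p)) = col A p"
proof -
  let ?m = "dim_row A" and ?N = "nonbasis A B"
  let ?q = "index_pos ?N p" and ?P = "basis_inv A B * cols_of A (nonbasis A B)"
  note inv = basis_inv[OF B]
  have N: "?N \<subseteq> {..<dim_col A}" "finite ?N" by (auto simp: nonbasis_def)
  have C: "cols_of A B \<in> carrier_mat ?m ?m"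
    using cols_of_carrier[OF is_basis_subset[OF B]] is_basis_card[OF B] by simp
  have CN: "cols_of A ?N \<in> carrier_mat ?m (card ?N)" by (rule cols_of_carrier[OF N(1)])
  have q: "?q < card ?N" using index_pos_less[OF N(2) p] .
  have P: "?P \<in> carrier_mat ?m (card ?N)" using inv(1) CN by simp
  have entry: "dictionary A b c B (Some i) (Some p) = col ?P ?q $ index_pos B i" if "i \<in> B" for i
    using that index_pos_less[OF is_basis_finite[OF B] that] P q inv(1) CN is_basis_card[OF B]
    by (simp add: Let_def)
  have v: "col ?P ?q \<in> carrier_vec (card B)"
    using inv(1) is_basis_card[OF B] by (intro carrier_vecI) simp
  have "col_comb A B (\<lambda>i. dictionary A b c B (Some i) (Some p)) = cols_of A B *\<^sub>v col ?P ?q"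
    unfolding cols_of_mult_vec[OF is_basis_subset[OF B] v]
    by (simp add: col_comb_def entry del: dictionary.simps)
  also have "\<dots> = col (cols_of A B * ?P) ?q"
    using col_mult2[OF C P q] by simp
  also have "cols_of A B * ?P = cols_of A ?N"
    using assoc_mult_mat[OF C inv(1) CN] inv(2) CN by simp
  also have "col (cols_of A ?N) ?q = col A p"
    using CN q p N by (intro eq_vecI) (auto simp: cols_of_index pick_index_pos nonbasis_def)
  finally show ?thesis .
qed

section \<open>Pivoting\<close>

text \<open>Substituting the expansion of column \<open>p\<close> in the basis turns a combination over the new index
  set into one over \<open>B\<close>; both halves of the exchange are read off from it.\<close>

lemma col_comb_exchange:
  fixes A :: "real mat" and b c :: "real vec"
  assumes B: "is_basis A B" and p: "p \<in> nonbasis A B" and r: "r \<in> B"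
  defines "e \<equiv> \<lambda>i. dictionary A b c B (Some i) (Some p)"
  shows "col_comb A (B \<union> {p} - {r}) y
    = col_comb A B (\<lambda>i. (if i = r then 0 else y i) + y p * e i)"
proof (rule eq_vecI)
  fix k assume "k < dim_vec (col_comb A B (\<lambda>i. (if i = r then 0 else y i) + y p * e i))"
  then have k: "k < dim_row A" by (simp add: col_comb_def)
  have fin: "finite B" by (rule is_basis_finite[OF B])
  have pB: "p \<notin> B" "p < dim_col A" "p \<noteq> r" using p r by (auto simp: nonbasis_def)
  have col: "A $$ (k, p) = (\<Sum>i\<in>B. A $$ (k, i) * e i)"
  proof -
    have "col A p $ k = col_comb A B e $ k"
      using col_comb_dictionary_col[OF B p, of b c] by (simp add: e_def)
    then show ?thesis using k pB by (simp add: col_comb_def)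
  qed
  have "B \<union> {p} - {r} = insert p (B - {r})" using pB r by auto
  then have "(\<Sum>i\<in>B \<union> {p} - {r}. A $$ (k, i) * y i)
      = A $$ (k, p) * y p + (\<Sum>i\<in>B - {r}. A $$ (k, i) * y i)"
    using fin pB by simp
  also have "(\<Sum>i\<in>B - {r}. A $$ (k, i) * y i)
      = (\<Sum>i\<in>B. A $$ (k, i) * (if i = r then 0 else y i))"
    by (rule sum.mono_neutral_cong_left) (use fin in auto)
  finally show "col_comb A (B \<union> {p} - {r}) y $ k
      = col_comb A B (\<lambda>i. (if i = r then 0 else y i) + y p * e i) $ k"
    using k by (simp add: col_comb_def col sum.distrib sum_distrib_left algebra_simps)
qed (simp add: col_comb_def)

lemma is_basis_pivot:
  assumes B: "is_basis A B" and p: "p \<in> nonbasis A B" and r: "r \<in> B"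
    and nz: "dictionary A b c B (Some r) (Some p) \<noteq> 0"
  shows "is_basis A (B \<union> {p} - {r})"
proof -
  let ?e = "\<lambda>i. dictionary A b c B (Some i) (Some p)"
  let ?B' = "B \<union> {p} - {r}"
  have pB: "p \<notin> B" "p < dim_col A" using p by (auto simp: nonbasis_def)
  have "?B' = insert p (B - {r})" using pB r by auto
  then have "card ?B' = dim_row A"
    using is_basis_finite[OF B] pB r card_Suc_Diff1[of B r] is_basis_card[OF B] by simp
  moreover have "?B' \<subseteq> {..<dim_col A}" using is_basis_subset[OF B] pB by auto
  moreover have "y i = 0" if y: "col_comb A ?B' y = 0\<^sub>v (dim_row A)" and i: "i \<in> ?B'" for y i
  proof -
    have zero: "(if j = r then 0 else y j) + y p * ?e j = 0" if "j \<in> B" for j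
    proof (rule basis_coefficients_unique[OF B _ that])
      show "col_comb A B (\<lambda>j. (if j = r then 0 else y j) + y p * ?e j) = col_comb A B (\<lambda>_. 0)"
        unfolding col_comb_exchange[OF B p r, of y b c, symmetric] y
        by (auto simp: col_comb_def)
    qed
    have "y p = 0" using zero[OF r] nz by simp
    then show ?thesis using zero[of i] i by auto
  qed
  ultimately show ?thesis using is_basis_iff by blast
qed

lemma basic_solution_pivot:
  fixes A :: "real mat" and b c :: "real vec"
  assumes B: "is_basis A B" and b: "b \<in> carrier_vec (dim_row A)"
    and p: "p \<in> nonbasis A B" and r: "r \<in> B"
    and nz: "dictionary A b c B (Some r) (Some p) \<noteq> 0"
    and i: "i \<in> B \<union> {p} - {r}"
  defines "d \<equiv> dictionary A b c B"
  defines "t \<equiv> d (Some r) None / d (Some r) (Some p)"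
  shows "dictionary A b c (B \<union> {p} - {r}) (Some i) None
    = (if i = p then t else d (Some i) None - t * d (Some i) (Some p))"
proof -
  let ?B' = "B \<union> {p} - {r}"
  let ?y = "\<lambda>i. if i = p then t else d (Some i) None - t * d (Some i) (Some p)"
  have pB: "p \<notin> B" using p by (auto simp: nonbasis_def)
  \<comment> \<open>\<open>t\<close> is chosen so that the coefficient of column \<open>r\<close> is again the old one.\<close>
  have "(if j = r then 0 else ?y j) + ?y p * d (Some j) (Some p) = d (Some j) None" if "j \<in> B" for j
    using that pB nz by (auto simp: t_def d_def simp del: dictionary.simps)
  then have "col_comb A ?B' ?y = col_comb A B (\<lambda>j. d (Some j) None)"
    unfolding col_comb_exchange[OF B p r, of ?y b c, folded d_def]
    by (simp add: col_comb_def)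
  also have "\<dots> = col_comb A ?B' (\<lambda>i. dictionary A b c ?B' (Some i) None)"
    unfolding d_def col_comb_basic_solution[OF B b]
      col_comb_basic_solution[OF is_basis_pivot[OF B p r nz] b] ..
  finally show ?thesis
    by (rule basis_coefficients_unique[OF is_basis_pivot[OF B p r nz] _ i, symmetric])
qed

section \<open>The potential\<close>

definition infeasibility :: "real mat \<Rightarrow> real vec \<Rightarrow> real vec \<Rightarrow> nat set \<Rightarrow> real" where
  "infeasibility A b c B = (\<Sum>i\<in>B. min (dictionary A b c B (Some i) None) 0)"

text \<open>Before the first sign change \<open>t\<close>, the infeasible variables contribute their full value to the
  potential and the feasible ones nothing; the leaving variable is \<open>0\<close> after the pivot, so losing its row
  costs nothing.  Hence the same formula covers a leaving variable that was infeasible and one that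
  was feasible, and the number of infeasible rows need not be tracked separately.\<close>

lemma infeasibility_pivot:
  fixes A :: "real mat" and b c :: "real vec"
  assumes B: "is_basis A B" and b: "b \<in> carrier_vec (dim_row A)"
    and p: "p \<in> nonbasis A B"
    and leave: "leaving_choice (dictionary A b c B) B p r"
  defines "d \<equiv> dictionary A b c B"
  defines "t \<equiv> d (Some r) None / d (Some r) (Some p)"
  shows "infeasibility A b c (B \<union> {p} - {r}) = infeasibility A b c B - t * infeasibility_vec d B p"
proof -
  let ?B' = "B \<union> {p} - {r}" and ?L = "infeasible_rows d B"
  let ?x = "\<lambda>i. d (Some i) None - t * d (Some i) (Some p)"
  have fin: "finite B" by (rule is_basis_finite[OF B])
  have pB: "p \<notin> B" using p by (auto simp: nonbasis_def)
  have r: "r \<in> B" and nz: "d (Some r) (Some p) \<noteq> 0" and t: "t \<ge> 0"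
    and ratio: "\<And>i. i \<in> ratio_rows d B p \<Longrightarrow> t \<le> d (Some i) None / d (Some i) (Some p)"
    using leave unfolding leaving_choice_def ratio_rows_def t_def d_def[symmetric]
    by (auto simp: zero_le_divide_iff)
  have infeas: "?x i \<le> 0" if "i \<in> ?L" for i
  proof (cases "d (Some i) (Some p) < 0")
    case True
    then show ?thesis
      using ratio[of i] that by (auto simp: ratio_rows_def infeasible_rows_def field_simps)
  next
    case False
    then have "0 \<le> t * d (Some i) (Some p)" using t by simp
    then show ?thesis using that unfolding infeasible_rows_def by auto
  qed
  have feas: "?x i \<ge> 0" if "i \<in> B - ?L" for i
  proof (cases "d (Some i) (Some p) > 0")
    case True
    then show ?thesis
      using ratio[of i] that by (auto simp: ratio_rows_def infeasible_rows_def field_simps)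
  next
    case False
    then have "t * d (Some i) (Some p) \<le> 0" using t by (simp add: mult_nonneg_nonpos)
    then show ?thesis using that unfolding infeasible_rows_def by auto
  qed
  have split: "(\<Sum>i\<in>B. min (f i) 0) = (\<Sum>i\<in>?L. f i)"
    if "\<And>i. i \<in> ?L \<Longrightarrow> f i \<le> 0" "\<And>i. i \<in> B - ?L \<Longrightarrow> f i \<ge> 0" for f :: "nat \<Rightarrow> real"
  proof (rule sum.mono_neutral_cong_right[OF fin])
    show "?L \<subseteq> B" by (auto simp: infeasible_rows_def)
    show "\<forall>i\<in>B - ?L. min (f i) 0 = 0" using that(2) by (simp add: min_absorb2)
    show "min (f i) 0 = f i" if "i \<in> ?L" for i
      using \<open>\<And>i. i \<in> ?L \<Longrightarrow> f i \<le> 0\<close> that by (simp add: min_absorb1)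
  qed
  have "?B' = insert p (B - {r})" using pB r by auto
  then have "infeasibility A b c ?B'
      = min (dictionary A b c ?B' (Some p) None) 0
        + (\<Sum>i\<in>B - {r}. min (dictionary A b c ?B' (Some i) None) 0)"
    using fin pB unfolding infeasibility_def by simp
  also have "dictionary A b c ?B' (Some p) None = t"
    using basic_solution_pivot[OF B b p r nz[unfolded d_def], of p] pB r
    by (auto simp: d_def t_def simp del: dictionary.simps)
  also have "(\<Sum>i\<in>B - {r}. min (dictionary A b c ?B' (Some i) None) 0)
      = (\<Sum>i\<in>B - {r}. min (?x i) 0)"
  proof (rule sum.cong[OF refl])
    fix i assume "i \<in> B - {r}"
    then show "min (dictionary A b c ?B' (Some i) None) 0 = min (?x i) 0"
      using basic_solution_pivot[OF B b p r nz[unfolded d_def], of i] pB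
      by (auto simp: d_def t_def simp del: dictionary.simps)
  qed
  also have "\<dots> = (\<Sum>i\<in>B. min (?x i) 0)"
    using fin nz by (intro sum.mono_neutral_left) (auto simp: t_def)
  also have "\<dots> = (\<Sum>i\<in>?L. ?x i)" using infeas feas by (rule split)
  also have "\<dots> = (\<Sum>i\<in>?L. d (Some i) None) - t * infeasibility_vec d B p"
    by (simp add: sum_subtractf sum_distrib_left infeasibility_vec_def)
  also have "(\<Sum>i\<in>?L. d (Some i) None) = infeasibility A b c B"
    unfolding infeasibility_def d_def[symmetric]
    by (rule split[symmetric]) (auto simp: infeasible_rows_def)
  finally show ?thesis using t by simp
qed

section \<open>Runs of the algorithm\<close>

lemma phase1_step_basis:
  assumes "phase1_step A b c (At B) (At B')"
  shows "is_basis A B'"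
  using assms
proof cases
  case (pivot p r)
  then have "p \<in> nonbasis A B" "r \<in> B" "dictionary A b c B (Some r) (Some p) \<noteq> 0"
    by (auto simp: entering_choice_def candidate_cols_def leaving_choice_def ratio_rows_def
        simp del: dictionary.simps)
  then show ?thesis using pivot is_basis_pivot by simp
qed

lemma phase1_step_infeasibility_less:
  assumes step: "phase1_step A b c (At B) (At B')"
    and b: "b \<in> carrier_vec (dim_row A)" and nondeg: "completely_nondegenerate A b c"
  shows "infeasibility A b c B < infeasibility A b c B'"
  using step
proof cases
  case (pivot p r)
  let ?d = "dictionary A b c B"
  have p: "p \<in> nonbasis A B" and W: "infeasibility_vec ?d B p < 0"
    using pivot by (auto simp: entering_choice_def candidate_cols_def)
  have t: "?d (Some r) None / ?d (Some r) (Some p) > 0"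
    using pivot nondeg
    by (force simp: leaving_choice_def ratio_rows_def completely_nondegenerate_def
        zero_less_divide_iff simp del: dictionary.simps)
  then show ?thesis
    using infeasibility_pivot[OF \<open>is_basis A B\<close> b p, of c r] pivot mult_pos_neg[OF t W]
    by (simp del: dictionary.simps times_divide_eq_left)
qed

lemma phase1_step_exists:
  assumes B: "is_basis A B"
  shows "\<exists>s. phase1_step A b c (At B) s"
proof -
  let ?d = "dictionary A b c B" and ?N = "nonbasis A B"
  let ?L = "infeasible_rows ?d B" and ?K = "candidate_cols ?d B ?N"
  consider "?L = {}" | "?L \<noteq> {}" "?K = {}" | "?L \<noteq> {}" "?K \<noteq> {}" by blast
  then show ?thesis
  proof cases
    case 3
    have finK: "finite ?K" by (simp add: candidate_cols_def nonbasis_def)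
    define p where "p = arg_min_on (infeasibility_vec ?d B) ?K"
    have pK: "p \<in> ?K" unfolding p_def using arg_min_if_finite(1)[OF finK 3(2)] .
    have enter: "entering_choice ?d B ?N p"
      unfolding entering_choice_def
      using pK arg_min_least[OF finK 3(2)] by (auto simp: p_def)
    have "\<exists>l\<in>?L. ?d (Some l) (Some p) < 0"
      using pK sum_nonneg[of ?L "\<lambda>l. ?d (Some l) (Some p)"]
      unfolding candidate_cols_def infeasibility_vec_def
      by (force simp: not_less simp del: dictionary.simps)
    then have ne: "ratio_rows ?d B p \<noteq> {}"
      by (auto simp: ratio_rows_def infeasible_rows_def simp del: dictionary.simps)
    have finR: "finite (ratio_rows ?d B p)"
      using is_basis_finite[OF B] by (simp add: ratio_rows_def)
    define r where
      "r = arg_min_on (\<lambda>i. ?d (Some i) None / ?d (Some i) (Some p)) (ratio_rows ?d B p)"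
    have "leaving_choice ?d B p r"
      unfolding leaving_choice_def
      using arg_min_if_finite(1)[OF finR ne] arg_min_least[OF finR ne]
      by (auto simp: r_def simp del: dictionary.simps)
    then show ?thesis using phase1_step.pivot[OF B 3(1) enter] by blast
  qed (use B phase1_step.intros in blast)+
qed

theorem mainTheorem1:
  fixes A :: "real mat" and b c :: "real vec" and m n :: nat and B :: "nat set"
  assumes "A \<in> carrier_mat m n"
    and "b \<in> carrier_vec m"
    and "c \<in> carrier_vec n"
    and "completely_nondegenerate A b c"
    and "is_basis A B"
  shows "always_terminates (phase1_step A b c) is_exit (At B)"
proof -
  have b: "b \<in> carrier_vec (dim_row A)" using assms(1,2) by auto
  have no_run: False
    if run: "\<And>k. phase1_step A b c (f k) (f (Suc k))" for f :: "nat \<Rightarrow> phase1_state"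
  proof -
    \<comment> \<open>Exit states have no successor, so an infinite run consists of pivots only.\<close>
    have "\<exists>B. f k = At B \<and> is_basis A B" for k
      using run[of k] by cases auto
    then obtain S where S: "\<And>k. f k = At (S k)" "\<And>k. is_basis A (S k)" by metis
    have "infeasibility A b c (S k) < infeasibility A b c (S (Suc k))" for k
      using phase1_step_infeasibility_less[OF _ b assms(4)] run[of k] by (simp add: S(1))
    then have "strict_mono (\<lambda>k. infeasibility A b c (S k))" by (simp add: strict_mono_Suc_iff)
    then have "inj S" by (metis (no_types, lifting) injI strict_mono_eq)
    moreover have "range S \<subseteq> Pow {..<dim_col A}" using S(2) is_basis_subset by blast
    then have "finite (range S)" by (rule finite_subset) simp
    ultimately show False using finite_imageD infinite_UNIV_nat by blast
  qed
  have reach: "is_exit t \<or> (\<exists>B'. t = At B' \<and> is_basis A B')"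
    if "(phase1_step A b c)\<^sup>*\<^sup>* (At B) t" for t
    using that
  proof (induction rule: rtranclp_induct)
    case base
    then show ?case using assms(5) by simp
  next
    case (step s t)
    then show ?case
      by (cases t) (auto elim: phase1_step.cases intro: phase1_step_basis)
  qed
  show ?thesis
    unfolding always_terminates_def using no_run reach phase1_step_exists by blast
qed

end
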